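(* Let $F$ be a field. Let $Q$ be the quiver obtained by gluing two oriented cycles $C(1)$ and $C(2)$ at a vertex $v$. Let $\alpha$ be the arrow of $C(1)$ ending in $v$ and let $\beta$ be the arrow of $C(2)$ starting from $v$. Then the algebra $A=FQ/(\alpha\beta)$ is PI, where $(\alpha\beta)$ is the two-sided ideal of $FQ$ generated by the path $\alpha\beta$.
   Context: For $n\ge 1$, the oriented cycle $C_n$ is the quiver with $n$ vertices $1,\dots,n$ and $n$ arrows $\alpha_i:i\to i+1$ (indices modulo $n$); $C_1$ is a loop. The quiver obtained by gluing $C(1)=C_n$ and $C(2)=C_m$ at a vertex $v$ is the quiver obtained from the disjoint union of $C_n$ and $C_m$ by identifying one vertex of $C_n$ with one vertex of $C_m$, the resulting common vertex being called $v$; all arrows remain distinct. A path of length $r\ge 1$ in a quiver is a sequence $\alpha_1\alpha_2\cdots\alpha_r$ of arrows with $t(\alpha_i)=s(\alpha_{i+1})$, where $s,t$ denote starting and terminal vertices; for each vertex $u$ there is also a lazy path $e_u$ of length $0$ from $u$ to $u$. The path algebra $FQ$ is the $F$-vector space with basis all paths in $Q$ (including lazy paths), with multiplication of paths given by concatenation $pq$ if $t(p)=s(q)$ and $0$ otherwise. An associative $F$-algebra $A$ is PI if there is a nonzero non-commutative polynomial $f\in F\langle x_1,\dots,x_N\rangle$ (for some $N$) such that $f(a_1,\dots,a_N)=0$ for all $a_1,\dots,a_N\in A$. *)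

theory Defs
  imports "Graph_Theory.Arc_Walk" "HOL-Algebra.QuotRing" "HOL-Algebra.Module"
begin

section \<open>Quivers\<close>

text \<open>
  A quiver is a \<^typ>\<open>('v, 'e) pre_digraph\<close>, which allows loops and parallel arrows;
  \<^const>\<open>tail\<close> and \<^const>\<open>head\<close> give the starting and the terminal vertex of an arrow.
\<close>

definition oriented_cycle :: "nat \<Rightarrow> (nat, nat) pre_digraph" where
  "oriented_cycle n = \<lparr>verts = {1..n}, arcs = {1..n}, tail = (\<lambda>i. i), head = (\<lambda>i. i mod n + 1)\<rparr>"

text \<open>
  The vertex \<open>y\<close> of the second quiver is identified with the vertex \<open>x\<close> of the first one;
  the class of the two is represented by \<open>Inl x\<close>.
\<close>

definition glue_vertex :: "'a \<Rightarrow> 'b \<Rightarrow> 'a + 'b \<Rightarrow> 'a + 'b" where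
  "glue_vertex x y z = (if z = Inr y then Inl x else z)"

definition glue ::
  "('a, 'e) pre_digraph \<Rightarrow> 'a \<Rightarrow> ('b, 'f) pre_digraph \<Rightarrow> 'b \<Rightarrow> ('a + 'b, 'e + 'f) pre_digraph" where
  "glue G x H y =
    \<lparr>verts = glue_vertex x y ` (verts G <+> verts H),
     arcs = arcs G <+> arcs H,
     tail = glue_vertex x y \<circ> map_sum (tail G) (tail H),
     head = glue_vertex x y \<circ> map_sum (head G) (head H)\<rparr>"

text \<open>
  A path is encoded as a pair of its starting vertex and its list of arrows, so that
  \<open>(u, [])\<close> is the lazy path at \<open>u\<close>.
\<close>

type_synonym ('v, 'e) qpath = "'v \<times> 'e list"

definition qpaths :: "('v, 'e) pre_digraph \<Rightarrow> ('v, 'e) qpath set" where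
  "qpaths Q = {(u, es). \<exists>w. pre_digraph.awalk Q u es w}"

definition path_source :: "('v, 'e) qpath \<Rightarrow> 'v" where
  "path_source p = fst p"

definition path_target :: "('v, 'e) pre_digraph \<Rightarrow> ('v, 'e) qpath \<Rightarrow> 'v" where
  "path_target Q p = pre_digraph.awlast Q (fst p) (snd p)"

definition path_concat :: "('v, 'e) qpath \<Rightarrow> ('v, 'e) qpath \<Rightarrow> ('v, 'e) qpath" where
  "path_concat p q = (fst p, snd p @ snd q)"


section \<open>Path algebras\<close>

text \<open>
  Elements are finitely supported coefficient functions on paths. The product is the bilinear
  extension of concatenation: the coefficient of \<open>p\<close> in \<open>f g\<close> is the sum of \<open>f q \<otimes> g r\<close> over the
  (finitely many) decompositions \<open>p = q r\<close>. The unit is the sum of all lazy paths, which is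
  finitely supported only for quivers with finitely many vertices.
\<close>

definition path_algebra ::
  "('k, 'm) ring_scheme \<Rightarrow> ('v, 'e) pre_digraph \<Rightarrow> ('k, ('v, 'e) qpath \<Rightarrow> 'k) module" where
  "path_algebra F Q =
    \<lparr>carrier = {f. (\<forall>p. f p \<in> carrier F) \<and> (\<forall>p. p \<notin> qpaths Q \<longrightarrow> f p = \<zero>\<^bsub>F\<^esub>)
                  \<and> finite {p. f p \<noteq> \<zero>\<^bsub>F\<^esub>}},
     mult = (\<lambda>f g p. \<Oplus>\<^bsub>F\<^esub>d \<in> {(q, r). q \<in> qpaths Q \<and> r \<in> qpaths Q
                \<and> path_target Q q = path_source r \<and> path_concat q r = p}. f (fst d) \<otimes>\<^bsub>F\<^esub> g (snd d)),
     one = (\<lambda>p. if p \<in> qpaths Q \<and> snd p = [] then \<one>\<^bsub>F\<^esub> else \<zero>\<^bsub>F\<^esub>),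
     zero = (\<lambda>p. \<zero>\<^bsub>F\<^esub>),
     add = (\<lambda>f g p. f p \<oplus>\<^bsub>F\<^esub> g p),
     smult = (\<lambda>c f p. c \<otimes>\<^bsub>F\<^esub> f p)\<rparr>"

definition path_basis :: "('k, 'm) ring_scheme \<Rightarrow> ('v, 'e) qpath \<Rightarrow> ('v, 'e) qpath \<Rightarrow> 'k" where
  "path_basis F p = (\<lambda>q. if q = p then \<one>\<^bsub>F\<^esub> else \<zero>\<^bsub>F\<^esub>)"


section \<open>Associative algebras and polynomial identities\<close>

text \<open>The library locale \<^locale>\<open>algebra\<close> covers commutative algebras only.\<close>

locale assoc_algebra = module F A + ring A
  for F :: "('k, 'm) ring_scheme" and A :: "('k, 'a, 'n) module_scheme" +
  assumes smult_mult_left: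
      "\<lbrakk>c \<in> carrier F; x \<in> carrier A; y \<in> carrier A\<rbrakk>
        \<Longrightarrow> (c \<odot>\<^bsub>A\<^esub> x) \<otimes>\<^bsub>A\<^esub> y = c \<odot>\<^bsub>A\<^esub> (x \<otimes>\<^bsub>A\<^esub> y)"
    and smult_mult_right:
      "\<lbrakk>c \<in> carrier F; x \<in> carrier A; y \<in> carrier A\<rbrakk>
        \<Longrightarrow> x \<otimes>\<^bsub>A\<^esub> (c \<odot>\<^bsub>A\<^esub> y) = c \<odot>\<^bsub>A\<^esub> (x \<otimes>\<^bsub>A\<^esub> y)"

text \<open>
  \<^const>\<open>FactRing\<close> forgets the scalar multiplication; it is put back as
  \<open>c (I + x) = I + c x\<close>, in the style of \<^const>\<open>rcoset_mult\<close>.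
\<close>

definition quotient_algebra ::
  "('k, 'a, 'n) module_scheme \<Rightarrow> 'a set \<Rightarrow> ('k, 'a set) module" where
  "quotient_algebra A I =
    \<lparr>carrier = carrier (A Quot I), mult = mult (A Quot I), one = one (A Quot I),
     zero = zero (A Quot I), add = add (A Quot I),
     smult = (\<lambda>c X. \<Union>x\<in>X. I +>\<^bsub>A\<^esub> (c \<odot>\<^bsub>A\<^esub> x))\<rparr>"

text \<open>
  Non-commutative polynomials in \<open>x\<^sub>1, \<dots>, x\<^sub>N\<close> are finitely supported coefficient functions on
  words in the indices \<open>1, \<dots>, N\<close>; the empty word stands for the constant monomial.
\<close>

definition nc_polys :: "('k, 'm) ring_scheme \<Rightarrow> nat \<Rightarrow> (nat list \<Rightarrow> 'k) set" where
  "nc_polys F N = {f. (\<forall>w. f w \<in> carrier F) \<and> (\<forall>w. \<not> set w \<subseteq> {1..N} \<longrightarrow> f w = \<zero>\<^bsub>F\<^esub>)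
                    \<and> finite {w. f w \<noteq> \<zero>\<^bsub>F\<^esub>}}"

definition nc_eval ::
  "('k, 'm) ring_scheme \<Rightarrow> ('k, 'a, 'n) module_scheme \<Rightarrow> (nat list \<Rightarrow> 'k) \<Rightarrow> (nat \<Rightarrow> 'a) \<Rightarrow> 'a" where
  "nc_eval F A f a =
    (\<Oplus>\<^bsub>A\<^esub>w \<in> {w. f w \<noteq> \<zero>\<^bsub>F\<^esub>}. f w \<odot>\<^bsub>A\<^esub> foldr (\<lambda>i b. a i \<otimes>\<^bsub>A\<^esub> b) w \<one>\<^bsub>A\<^esub>)"

definition PI_algebra :: "('k, 'm) ring_scheme \<Rightarrow> ('k, 'a, 'n) module_scheme \<Rightarrow> bool" where
  "PI_algebra F A \<longleftrightarrow> assoc_algebra F A \<and>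
    (\<exists>N. \<exists>f \<in> nc_polys F N. f \<noteq> (\<lambda>w. \<zero>\<^bsub>F\<^esub>) \<and>
      (\<forall>a \<in> {1..N} \<rightarrow> carrier A. nc_eval F A f a = \<zero>\<^bsub>A\<^esub>))"

end

theory Submission
  imports Defs "HOL-Combinatorics.Permutations" "HOL-Library.Multiset"
begin

text \<open>
  Colour the arrows of \<open>Q\<close> by the cycle they belong to. A path avoiding \<open>\<alpha>\<beta>\<close> runs first along
  \<open>C(2)\<close> and then along \<open>C(1)\<close>, so its sequence of colours is sorted; all other paths vanish in \<open>A\<close>.
  No vertex has two outgoing arrows of the same colour, hence a surviving path is determined by its
  starting vertex and the number of its arrows of each colour. Give a path the type (source, target,
  set of colours). If two factors of a product of paths have the same type, then exchanging them
  changes neither the composability of the product, nor whether it survives, nor these data: the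
  product in \<open>A\<close> stays the same. There are finitely many types, so for \<open>N\<close> larger than their number
  any \<open>N\<close> paths include two of the same type, and the signed sum of all their products cancels in
  pairs. The standard polynomial of degree \<open>N\<close> is multilinear, so it is an identity of \<open>A\<close>.
\<close>

section \<open>Associative algebras and standard polynomials\<close>

context assoc_algebra
begin

text \<open>As \<open>A\<close> has a unit, the scalar c acts as left multiplication by c 1, which
  every ring ideal absorbs.\<close>

lemma ideal_smult_closed:
  assumes "ideal I A" "c \<in> carrier F" "x \<in> I"
  shows "c \<odot>\<^bsub>A\<^esub> x \<in> I"
proof -
  interpret ideal I A by fact
  have "c \<odot>\<^bsub>A\<^esub> x = (c \<odot>\<^bsub>A\<^esub> \<one>\<^bsub>A\<^esub>) \<otimes>\<^bsub>A\<^esub> x"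
    using assms by (simp add: smult_mult_left)
  then show ?thesis
    using assms by (simp add: I_l_closed)
qed

lemma quotient_algebra_simps:
  assumes "ideal I A"
  shows quotient_carrier: "carrier (quotient_algebra A I) = (+>\<^bsub>A\<^esub>) I ` carrier A"
    and quotient_zero: "\<zero>\<^bsub>quotient_algebra A I\<^esub> = I"
    and quotient_one: "\<one>\<^bsub>quotient_algebra A I\<^esub> = I +>\<^bsub>A\<^esub> \<one>\<^bsub>A\<^esub>"
    and quotient_add: "\<lbrakk>x \<in> carrier A; y \<in> carrier A\<rbrakk>
      \<Longrightarrow> (I +>\<^bsub>A\<^esub> x) \<oplus>\<^bsub>quotient_algebra A I\<^esub> (I +>\<^bsub>A\<^esub> y) = I +>\<^bsub>A\<^esub> (x \<oplus>\<^bsub>A\<^esub> y)"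
    and quotient_mult: "\<lbrakk>x \<in> carrier A; y \<in> carrier A\<rbrakk>
      \<Longrightarrow> (I +>\<^bsub>A\<^esub> x) \<otimes>\<^bsub>quotient_algebra A I\<^esub> (I +>\<^bsub>A\<^esub> y) = I +>\<^bsub>A\<^esub> (x \<otimes>\<^bsub>A\<^esub> y)"
    and quotient_smult: "\<lbrakk>c \<in> carrier F; x \<in> carrier A\<rbrakk>
      \<Longrightarrow> c \<odot>\<^bsub>quotient_algebra A I\<^esub> (I +>\<^bsub>A\<^esub> x) = I +>\<^bsub>A\<^esub> (c \<odot>\<^bsub>A\<^esub> x)"
proof -
  interpret ideal I A by fact
  show "carrier (quotient_algebra A I) = (+>\<^bsub>A\<^esub>) I ` carrier A"
    and "\<zero>\<^bsub>quotient_algebra A I\<^esub> = I"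
    and "\<one>\<^bsub>quotient_algebra A I\<^esub> = I +>\<^bsub>A\<^esub> \<one>\<^bsub>A\<^esub>"
    by (auto simp: quotient_algebra_def FactRing_simps)
  show "(I +>\<^bsub>A\<^esub> x) \<oplus>\<^bsub>quotient_algebra A I\<^esub> (I +>\<^bsub>A\<^esub> y) = I +>\<^bsub>A\<^esub> (x \<oplus>\<^bsub>A\<^esub> y)"
    "(I +>\<^bsub>A\<^esub> x) \<otimes>\<^bsub>quotient_algebra A I\<^esub> (I +>\<^bsub>A\<^esub> y) = I +>\<^bsub>A\<^esub> (x \<otimes>\<^bsub>A\<^esub> y)"
    if "x \<in> carrier A" "y \<in> carrier A"
    using that by (simp_all add: quotient_algebra_def FactRing_def a_rcos_sum rcoset_mult_add)
  show "c \<odot>\<^bsub>quotient_algebra A I\<^esub> (I +>\<^bsub>A\<^esub> x) = I +>\<^bsub>A\<^esub> (c \<odot>\<^bsub>A\<^esub> x)"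
    if c: "c \<in> carrier F" and x: "x \<in> carrier A"
  proof -
    \<comment> \<open>Scaling a coset is a union over its elements z = h + x with h in I. They all
      give the same coset, since c z and c x differ by c h, which lies in I.\<close>
    have "I +>\<^bsub>A\<^esub> (c \<odot>\<^bsub>A\<^esub> z) = I +>\<^bsub>A\<^esub> (c \<odot>\<^bsub>A\<^esub> x)" if z: "z \<in> I +>\<^bsub>A\<^esub> x" for z
    proof -
      obtain h where h: "h \<in> I" "z = h \<oplus>\<^bsub>A\<^esub> x"
        using z by (auto simp: a_r_coset_def r_coset_def)
      then have "c \<odot>\<^bsub>A\<^esub> z = c \<odot>\<^bsub>A\<^esub> h \<oplus>\<^bsub>A\<^esub> c \<odot>\<^bsub>A\<^esub> x"
        using c x by (simp add: smult_r_distr)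
      moreover have "c \<odot>\<^bsub>A\<^esub> h \<in> I"
        using assms c h by (intro ideal_smult_closed)
      ultimately have "c \<odot>\<^bsub>A\<^esub> z \<in> I +>\<^bsub>A\<^esub> (c \<odot>\<^bsub>A\<^esub> x)"
        using a_rcosI[OF _ a_subset smult_closed[OF c x]] by simp
      then show ?thesis
        using c x by (intro a_repr_independence'[symmetric]) simp_all
    qed
    then have "(\<Union>z\<in>I +>\<^bsub>A\<^esub> x. I +>\<^bsub>A\<^esub> (c \<odot>\<^bsub>A\<^esub> z)) = I +>\<^bsub>A\<^esub> (c \<odot>\<^bsub>A\<^esub> x)"
      using a_rcos_self[OF x] by blast
    then show ?thesis
      by (simp add: quotient_algebra_def)
  qed
qed

lemma quotient_assoc_algebra:
  assumes I: "ideal I A"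
  shows "assoc_algebra F (quotient_algebra A I)"
proof -
  note simps = quotient_algebra_simps[OF I]
  have "ring (A Quot I)"
    using I by (rule ideal.quotient_is_ring)
  note ring = ringE[OF this] and abelian = abelian_groupE[OF ringE(1)[OF this]]
    and monoid = Group.monoid.m_closed[OF ringE(2)[OF this]] Group.monoid.one_closed[OF ringE(2)[OF this]]
      Group.monoid.m_assoc[OF ringE(2)[OF this]] Group.monoid.l_one[OF ringE(2)[OF this]]
      Group.monoid.r_one[OF ringE(2)[OF this]]
  \<comment> \<open>The record differs from \<open>A Quot I\<close> but has the same ring
    operations, so the ring axioms are carried over one by one.\<close>
  have abelian_group: "abelian_group (quotient_algebra A I)"
    by (rule abelian_groupI; simp add: quotient_algebra_def; rule abelian; assumption)
  have mult_monoid: "Group.monoid (quotient_algebra A I)"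
    by (rule monoidI; simp add: quotient_algebra_def; rule monoid; assumption)
  have ring: "ring (quotient_algebra A I)"
    by (rule ringI[OF abelian_group mult_monoid]; simp add: quotient_algebra_def; rule ring; assumption)
  from abelian_group have "module F (quotient_algebra A I)"
    by (rule moduleI[OF is_cring])
      (auto simp: simps smult_l_distr smult_r_distr smult_assoc1)
  then show ?thesis
    by (intro assoc_algebra.intro ring assoc_algebra_axioms.intro)
      (auto simp: simps smult_mult_left smult_mult_right)
qed

end

text \<open>Combinations grow by one term at a time, so that induction asks exactly for linearity in
  one argument at values of the form c b + x.\<close>

inductive_set lin_span :: "('k, 'm) ring_scheme \<Rightarrow> ('k, 'a, 'n) module_scheme \<Rightarrow> 'a set \<Rightarrow> 'a set"
  for F A B where
  zero: "\<zero>\<^bsub>A\<^esub> \<in> lin_span F A B"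
| add: "\<lbrakk>c \<in> carrier F; b \<in> B; x \<in> lin_span F A B\<rbrakk> \<Longrightarrow> c \<odot>\<^bsub>A\<^esub> b \<oplus>\<^bsub>A\<^esub> x \<in> lin_span F A B"

section \<open>Permutations written as words, and their signs\<close>

definition perm_words :: "nat \<Rightarrow> nat list set" where
  "perm_words N = {w. distinct w \<and> set w = {1..N}}"

text \<open>List positions start at 0 but variables at 1, hence the shift. All other numbers are
  fixed, so that a permutation word gives a permutation whose parity \<open>evenperm\<close> can
  read off.\<close>

definition word_perm :: "nat list \<Rightarrow> nat \<Rightarrow> nat" where
  "word_perm w i = (if i \<in> {1..length w} then w ! (i - 1) else i)"

text \<open>This is the standard polynomial, the sum of sgn(s) x_s(1) ... x_s(N) over all
  permutations s of 1, ..., N.\<close>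

definition standard_poly :: "('k, 'm) ring_scheme \<Rightarrow> nat \<Rightarrow> nat list \<Rightarrow> 'k" where
  "standard_poly F N w =
    (if w \<notin> perm_words N then \<zero>\<^bsub>F\<^esub> else if evenperm (word_perm w) then \<one>\<^bsub>F\<^esub> else \<ominus>\<^bsub>F\<^esub> \<one>\<^bsub>F\<^esub>)"

lemma finite_perm_words: "finite (perm_words N)"
proof -
  have "perm_words N \<subseteq> {w. set w \<subseteq> {1..N} \<and> length w \<le> N}"
    by (auto simp: perm_words_def simp flip: distinct_card)
  then show ?thesis
    by (rule finite_subset) (rule finite_lists_length_le, simp)
qed

lemma length_perm_words: "w \<in> perm_words N \<Longrightarrow> length w = N"
  by (auto simp: perm_words_def simp flip: distinct_card)

lemma word_perm_permutes:
  assumes "w \<in> perm_words N"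
  shows "word_perm w permutes {1..N}"
proof (rule bij_imp_permutes)
  have len: "length w = N"
    using assms by (rule length_perm_words)
  have "inj_on (word_perm w) {1..N}"
  proof (rule inj_onI)
    fix i j assume "i \<in> {1..N}" "j \<in> {1..N}" "word_perm w i = word_perm w j"
    moreover have "distinct w"
      using assms by (simp add: perm_words_def)
    ultimately have "i - 1 = j - 1" "1 \<le> i" "1 \<le> j"
      using len nth_eq_iff_index_eq[of w "i - 1" "j - 1"] by (auto simp: word_perm_def)
    then show "i = j"
      by linarith
  qed
  moreover have "word_perm w ` {1..N} = {1..N}"
  proof (rule endo_inj_surj)
    show "word_perm w ` {1..N} \<subseteq> {1..N}"
    proof (rule image_subsetI)
      fix i assume "i \<in> {1..N}"
      then show "word_perm w i \<in> {1..N}"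
        using assms nth_mem[of "i - 1" w] len by (auto simp: word_perm_def perm_words_def)
    qed
  qed (use calculation in simp_all)
  ultimately show "bij_betw (word_perm w) {1..N} {1..N}"
    by (simp add: bij_betw_def)
  show "word_perm w i = i" if "i \<notin> {1..N}" for i
    using that len by (auto simp: word_perm_def)
qed

lemma map_transpose_perm_words:
  assumes "w \<in> perm_words N" "i \<in> {1..N}" "j \<in> {1..N}"
  shows "map (transpose i j) w \<in> perm_words N"
proof -
  have "transpose i j ` {1..N} = {1..N}"
    using permutes_image[OF permutes_swap_id[OF assms(2,3)]] .
  moreover have "distinct (map (transpose i j) w)"
    using assms by (simp add: perm_words_def distinct_map inj_on_subset[OF inj_transpose])
  ultimately show ?thesis
    using assms by (simp add: perm_words_def)
qed

text \<open>Renaming the letters composes \<open>word_perm w\<close> with a transposition on the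
  left, which flips the parity.\<close>

lemma evenperm_map_transpose:
  assumes w: "w \<in> perm_words N" and ij: "i \<in> {1..N}" "j \<in> {1..N}" "i \<noteq> j"
  shows "evenperm (word_perm (map (transpose i j) w)) \<longleftrightarrow> \<not> evenperm (word_perm w)"
proof -
  have "word_perm (map (transpose i j) w) = transpose i j \<circ> word_perm w"
    using ij length_perm_words[OF w] by (auto simp: word_perm_def transpose_def fun_eq_iff)
  moreover have "permutation (word_perm w)"
    using word_perm_permutes[OF w] by (intro permutes_imp_permutation) auto
  ultimately show ?thesis
    using ij by (simp add: evenperm_comp evenperm_swap permutation_swap_id)
qed

lemma perm_words_nonempty: "perm_words N \<noteq> {}"
proof -
  have "[1..<Suc N] \<in> perm_words N"
    by (auto simp: perm_words_def)
  then show ?thesis by blast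
qed

section \<open>Multilinearity and vanishing of the standard polynomial\<close>

context assoc_algebra
begin

abbreviation word_eval where
  "word_eval a w \<equiv> foldr (\<lambda>i b. a i \<otimes>\<^bsub>A\<^esub> b) w \<one>\<^bsub>A\<^esub>"

lemma word_eval_closed: "(\<And>i. i \<in> set w \<Longrightarrow> a i \<in> carrier A) \<Longrightarrow> word_eval a w \<in> carrier A"
  by (induction w) auto

lemma word_eval_cong: "(\<And>i. i \<in> set w \<Longrightarrow> a i = b i) \<Longrightarrow> word_eval a w = word_eval b w"
  by (rule foldr_cong) auto

text \<open>Turns an exchange of letters in a word into an exchange of the substituted
  elements.\<close>

lemma word_eval_map: "word_eval a (map g w) = word_eval (a \<circ> g) w"
  by (simp add: foldr_map comp_def)

lemma word_eval_fun_upd_notin: "k \<notin> set w \<Longrightarrow> word_eval (a(k := x)) w = word_eval a w"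
  by (rule word_eval_cong) auto

lemma word_eval_zero:
  assumes "k \<in> set w" "\<And>i. i \<in> set w \<Longrightarrow> a i \<in> carrier A"
  shows "word_eval (a(k := \<zero>\<^bsub>A\<^esub>)) w = \<zero>\<^bsub>A\<^esub>"
  using assms
proof (induction w)
  case (Cons i w)
  have "word_eval (a(k := \<zero>\<^bsub>A\<^esub>)) w \<in> carrier A"
    using Cons.prems by (intro word_eval_closed) auto
  then show ?case
    using Cons by (cases "k \<in> set w") auto
qed simp

text \<open>In a distinct word the letter k occurs just once. The product expands at that letter,
  and the factors to its left distribute over the resulting sum.\<close>

lemma word_eval_linear:
  assumes "distinct w" "k \<in> set w" "\<And>i. i \<in> set w \<Longrightarrow> i \<noteq> k \<Longrightarrow> a i \<in> carrier A"
    and "c \<in> carrier F" "x \<in> carrier A" "y \<in> carrier A"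
  shows "word_eval (a(k := c \<odot>\<^bsub>A\<^esub> x \<oplus>\<^bsub>A\<^esub> y)) w =
    c \<odot>\<^bsub>A\<^esub> word_eval (a(k := x)) w \<oplus>\<^bsub>A\<^esub> word_eval (a(k := y)) w"
  using assms
proof (induction w)
  case (Cons i w)
  have closed: "word_eval (a(k := z)) w \<in> carrier A" if "z \<in> carrier A" for z
    using Cons.prems that by (intro word_eval_closed) auto
  show ?case
  proof (cases "i = k")
    case True
    then have "word_eval (a(k := z)) w = word_eval a w" for z
      using Cons.prems by (intro word_eval_fun_upd_notin) auto
    then show ?thesis
      using True Cons.prems closed[OF Cons.prems(5)] by (simp add: l_distr smult_mult_left)
  next
    case False
    then show ?thesis
      using Cons closed by (simp add: r_distr smult_mult_right)
  qed
qed simp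

text \<open>The sum runs over all permutation words, not over the support as in
  \<open>nc_eval\<close>, which spares any discussion of vanishing coefficients. The two index sets
  agree once 1 and 0 differ in F.\<close>

definition standard_eval where
  "standard_eval N a = (\<Oplus>\<^bsub>A\<^esub>w \<in> perm_words N. standard_poly F N w \<odot>\<^bsub>A\<^esub> word_eval a w)"

lemma standard_poly_closed: "standard_poly F N w \<in> carrier F"
  by (simp add: standard_poly_def)

lemma word_eval_perm_words_closed:
  "\<lbrakk>w \<in> perm_words N; a \<in> {1..N} \<rightarrow> carrier A\<rbrakk> \<Longrightarrow> word_eval a w \<in> carrier A"
  by (rule word_eval_closed) (auto simp: perm_words_def)

lemma standard_eval_zero:
  assumes "a \<in> {1..N} \<rightarrow> carrier A" "k \<in> {1..N}"
  shows "standard_eval N (a(k := \<zero>\<^bsub>A\<^esub>)) = \<zero>\<^bsub>A\<^esub>"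
  unfolding standard_eval_def
proof (rule M.add.finprod_one_eqI)
  fix w assume w: "w \<in> perm_words N"
  then have "word_eval (a(k := \<zero>\<^bsub>A\<^esub>)) w = \<zero>\<^bsub>A\<^esub>"
    using assms by (intro word_eval_zero) (auto simp: perm_words_def)
  then show "standard_poly F N w \<odot>\<^bsub>A\<^esub> word_eval (a(k := \<zero>\<^bsub>A\<^esub>)) w = \<zero>\<^bsub>A\<^esub>"
    by (simp add: standard_poly_closed)
qed

lemma standard_eval_linear:
  assumes a: "a \<in> {1..N} \<rightarrow> carrier A" and k: "k \<in> {1..N}"
    and c: "c \<in> carrier F" and x: "x \<in> carrier A" and y: "y \<in> carrier A"
  shows "standard_eval N (a(k := c \<odot>\<^bsub>A\<^esub> x \<oplus>\<^bsub>A\<^esub> y)) =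
    c \<odot>\<^bsub>A\<^esub> standard_eval N (a(k := x)) \<oplus>\<^bsub>A\<^esub> standard_eval N (a(k := y))"
proof -
  let ?s = "standard_poly F N"
  have closed: "word_eval (a(k := z)) w \<in> carrier A" if "w \<in> perm_words N" "z \<in> carrier A" for w z
    using that a by (intro word_eval_perm_words_closed) auto
  have "standard_eval N (a(k := c \<odot>\<^bsub>A\<^esub> x \<oplus>\<^bsub>A\<^esub> y)) =
      (\<Oplus>\<^bsub>A\<^esub>w \<in> perm_words N. c \<odot>\<^bsub>A\<^esub> (?s w \<odot>\<^bsub>A\<^esub> word_eval (a(k := x)) w) \<oplus>\<^bsub>A\<^esub>
        ?s w \<odot>\<^bsub>A\<^esub> word_eval (a(k := y)) w)"
    unfolding standard_eval_def
  proof (rule M.finsum_cong')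
    fix w assume w: "w \<in> perm_words N"
    have "word_eval (a(k := c \<odot>\<^bsub>A\<^esub> x \<oplus>\<^bsub>A\<^esub> y)) w =
        c \<odot>\<^bsub>A\<^esub> word_eval (a(k := x)) w \<oplus>\<^bsub>A\<^esub> word_eval (a(k := y)) w"
      using w a k c x y by (intro word_eval_linear) (auto simp: perm_words_def)
    then show "?s w \<odot>\<^bsub>A\<^esub> word_eval (a(k := c \<odot>\<^bsub>A\<^esub> x \<oplus>\<^bsub>A\<^esub> y)) w =
        c \<odot>\<^bsub>A\<^esub> (?s w \<odot>\<^bsub>A\<^esub> word_eval (a(k := x)) w) \<oplus>\<^bsub>A\<^esub> ?s w \<odot>\<^bsub>A\<^esub> word_eval (a(k := y)) w"
      using closed[OF w] c x y
      by (simp add: standard_poly_closed smult_r_distr R.m_comm flip: smult_assoc1)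
  qed (use closed c x y in \<open>auto simp: standard_poly_closed\<close>)
  also have "\<dots> = c \<odot>\<^bsub>A\<^esub> standard_eval N (a(k := x)) \<oplus>\<^bsub>A\<^esub> standard_eval N (a(k := y))"
    unfolding standard_eval_def using closed c x y
    by (subst finsum_smult_ldistr)
      (auto simp: finite_perm_words standard_poly_closed Pi_def intro!: M.finsum_addf)
  finally show ?thesis .
qed

text \<open>Multilinearity allows replacing the arguments one at a time, from elements of B to
  linear combinations of them.\<close>

lemma standard_eval_spanning:
  assumes B: "B \<subseteq> carrier A" and span: "carrier A \<subseteq> lin_span F A B"
    and vanish: "\<And>b. b \<in> {1..N} \<rightarrow> B \<Longrightarrow> standard_eval N b = \<zero>\<^bsub>A\<^esub>"
    and a: "a \<in> {1..N} \<rightarrow> carrier A"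
  shows "standard_eval N a = \<zero>\<^bsub>A\<^esub>"
proof -
  \<comment> \<open>The induction is over the set S of variables whose values may lie outside B; for
    empty S the claim is \<open>vanish\<close>.\<close>
  have "standard_eval N a = \<zero>\<^bsub>A\<^esub>"
    if "finite S" "S \<subseteq> {1..N}" "a \<in> {1..N} \<rightarrow> carrier A" "a \<in> {1..N} - S \<rightarrow> B" for S a
    using that
  proof (induction S arbitrary: a)
    case empty
    then show ?case
      by (intro vanish) auto
  next
    case (insert k S)
    have k: "k \<in> {1..N}"
      using insert.prems by simp
    \<comment> \<open>The value at k now runs through all linear combinations. Membership in the
      carrier is proved along with it because \<open>standard_eval_linear\<close> asks for
      it.\<close>
    have "x \<in> carrier A \<and> standard_eval N (a(k := x)) = \<zero>\<^bsub>A\<^esub>" if "x \<in> lin_span F A B" for x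
      using that
    proof induction
      case zero
      show ?case
        using standard_eval_zero[OF insert.prems(2) k] by (simp del: fun_upd_apply)
    next
      case (add c b x)
      have "standard_eval N (a(k := b)) = \<zero>\<^bsub>A\<^esub>"
      proof (rule insert.IH)
        show "a(k := b) \<in> {1..N} \<rightarrow> carrier A"
          using insert.prems(2) add.hyps(2) B by (auto simp: Pi_iff)
        show "a(k := b) \<in> {1..N} - S \<rightarrow> B"
          using insert.prems(3) add.hyps(2) by (auto simp: Pi_iff)
      qed (use insert.prems in auto)
      then show ?case
        using standard_eval_linear[OF insert.prems(2) k add.hyps(1), of b x] add B
        by (simp add: subset_iff del: fun_upd_apply)
    qed
    moreover have "a k \<in> lin_span F A B"
      using insert.prems k span by auto
    ultimately have "standard_eval N (a(k := a k)) = \<zero>\<^bsub>A\<^esub>"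
      by blast
    then show ?case
      by simp
  qed
  from this[of "{1..N}"] a show ?thesis
    by auto
qed

text \<open>Exchanging the letters i and j pairs each even word with an odd word of the same value,
  and every pair cancels. Pairing works in all characteristics; showing only that the sum equals its
  negative would fail in characteristic 2.\<close>

lemma standard_eval_symmetric_pair:
  assumes a: "a \<in> {1..N} \<rightarrow> carrier A"
    and ij: "i \<in> {1..N}" "j \<in> {1..N}" "i \<noteq> j"
    and sym: "\<And>w. w \<in> perm_words N \<Longrightarrow> word_eval (a \<circ> transpose i j) w = word_eval a w"
  shows "standard_eval N a = \<zero>\<^bsub>A\<^esub>"
proof -
  let ?W = "perm_words N" and ?t = "map (transpose i j)"
  let ?E = "{w \<in> ?W. evenperm (word_perm w)}"
  let ?s = "\<lambda>w. standard_poly F N w \<odot>\<^bsub>A\<^esub> word_eval a w"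
  have closed: "word_eval a w \<in> carrier A" if "w \<in> ?W" for w
    using that a by (rule word_eval_perm_words_closed)
  have s_closed: "?s w \<in> carrier A" if "w \<in> ?W" for w
    using closed[OF that] by (simp add: standard_poly_closed)
  have t_W: "?t w \<in> ?W" if "w \<in> ?W" for w
    using that ij by (simp add: map_transpose_perm_words)
  have t_even: "evenperm (word_perm (?t w)) \<longleftrightarrow> \<not> evenperm (word_perm w)" if "w \<in> ?W" for w
    using that ij by (rule evenperm_map_transpose)
  have t_t: "?t (?t w) = w" for w
    by (simp add: comp_def)
  \<comment> \<open>The exchange is an involution that flips parity, so the sum over the odd words
    can be reindexed by the even ones.\<close>
  have odd: "?W - ?E = ?t ` ?E"
  proof
    show "?W - ?E \<subseteq> ?t ` ?E"
    proof
      fix w assume "w \<in> ?W - ?E"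
      then have "?t w \<in> ?E"
        using t_W t_even by blast
      then show "w \<in> ?t ` ?E"
        using t_t by (metis imageI)
    qed
  qed (use t_W t_even in auto)
  have "inj_on ?t ?E"
    by (rule inj_on_inverseI) (rule t_t)
  have "standard_eval N a = (\<Oplus>\<^bsub>A\<^esub>w \<in> ?E \<union> (?W - ?E). ?s w)"
    unfolding standard_eval_def by (rule arg_cong2[where f = "finsum A"]) auto
  also have "\<dots> = (\<Oplus>\<^bsub>A\<^esub>w \<in> ?E. ?s w) \<oplus>\<^bsub>A\<^esub> (\<Oplus>\<^bsub>A\<^esub>w \<in> ?W - ?E. ?s w)"
    using s_closed by (intro M.finsum_Un_disjoint) (auto simp: finite_perm_words)
  also have "(\<Oplus>\<^bsub>A\<^esub>w \<in> ?W - ?E. ?s w) = (\<Oplus>\<^bsub>A\<^esub>w \<in> ?E. ?s (?t w))"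
    unfolding odd using s_closed t_W \<open>inj_on ?t ?E\<close> by (intro M.finsum_reindex) auto
  also have "(\<Oplus>\<^bsub>A\<^esub>w \<in> ?E. ?s w) \<oplus>\<^bsub>A\<^esub> (\<Oplus>\<^bsub>A\<^esub>w \<in> ?E. ?s (?t w)) =
      (\<Oplus>\<^bsub>A\<^esub>w \<in> ?E. ?s w \<oplus>\<^bsub>A\<^esub> ?s (?t w))"
    using s_closed t_W by (intro M.finsum_addf[symmetric]) auto
  also have "\<dots> = \<zero>\<^bsub>A\<^esub>"
  proof (rule M.add.finprod_one_eqI)
    fix w assume "w \<in> ?E"
    then have w: "w \<in> ?W" "evenperm (word_perm w)"
      by auto
    have "word_eval a (?t w) = word_eval a w"
      using sym[OF w(1)] by (simp only: word_eval_map)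
    then show "?s w \<oplus>\<^bsub>A\<^esub> ?s (?t w) = \<zero>\<^bsub>A\<^esub>"
      using w t_W[OF w(1)] t_even[OF w(1)] closed[OF w(1)]
      by (simp add: standard_poly_def smult_l_minus M.r_neg)
  qed
  finally show ?thesis .
qed

lemma PI_algebra_standardI:
  assumes "\<one>\<^bsub>F\<^esub> \<noteq> \<zero>\<^bsub>F\<^esub>"
    and vanish: "\<And>a. a \<in> {1..N} \<rightarrow> carrier A \<Longrightarrow> standard_eval N a = \<zero>\<^bsub>A\<^esub>"
  shows "PI_algebra F A"
proof -
  \<comment> \<open>Both signs are nonzero, so the support of the polynomial is the whole of
    \<open>perm_words N\<close>.\<close>
  have "\<ominus>\<^bsub>F\<^esub> \<one>\<^bsub>F\<^esub> \<noteq> \<zero>\<^bsub>F\<^esub>"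
    using assms(1) by (metis R.minus_minus R.minus_zero R.one_closed)
  then have nonzero: "standard_poly F N w \<noteq> \<zero>\<^bsub>F\<^esub> \<longleftrightarrow> w \<in> perm_words N" for w
    using assms(1) by (simp add: standard_poly_def)
  have "standard_poly F N \<in> nc_polys F N"
    by (simp add: nc_polys_def nonzero finite_perm_words standard_poly_closed)
      (simp add: standard_poly_def perm_words_def)
  moreover have "standard_poly F N \<noteq> (\<lambda>w. \<zero>\<^bsub>F\<^esub>)"
    using perm_words_nonempty nonzero by (metis ex_in_conv)
  moreover have "nc_eval F A (standard_poly F N) a = \<zero>\<^bsub>A\<^esub>" if "a \<in> {1..N} \<rightarrow> carrier A" for a
    using vanish[OF that] by (simp add: nc_eval_def standard_eval_def nonzero)
  ultimately show ?thesis
    unfolding PI_algebra_def using assoc_algebra_axioms by blast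
qed

section \<open>Words and spans under the projection to a quotient\<close>

lemma word_eval_quotient:
  assumes I: "ideal I A" and "\<And>i. i \<in> set w \<Longrightarrow> a i \<in> carrier A"
  shows "foldr (\<lambda>i b. (I +>\<^bsub>A\<^esub> a i) \<otimes>\<^bsub>quotient_algebra A I\<^esub> b) w \<one>\<^bsub>quotient_algebra A I\<^esub> =
    I +>\<^bsub>A\<^esub> word_eval a w"
  using assms(2)
  by (induction w) (simp_all add: quotient_algebra_simps[OF I] word_eval_closed)

lemma lin_span_quotient:
  assumes I: "ideal I A" and B: "B \<subseteq> carrier A" and x: "x \<in> lin_span F A B"
  shows "I +>\<^bsub>A\<^esub> x \<in> lin_span F (quotient_algebra A I) ((+>\<^bsub>A\<^esub>) I ` B)"
proof -
  let ?A = "quotient_algebra A I"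
  have "x \<in> carrier A \<and> I +>\<^bsub>A\<^esub> x \<in> lin_span F ?A ((+>\<^bsub>A\<^esub>) I ` B)"
    using x
  proof induction
    case zero
    have "I +>\<^bsub>A\<^esub> \<zero>\<^bsub>A\<^esub> = \<zero>\<^bsub>?A\<^esub>"
      using I by (simp add: quotient_zero[OF I] ideal.axioms additive_subgroup.a_subset)
    then show ?case
      by (simp add: lin_span.zero)
  next
    case (add c b x)
    then have "c \<odot>\<^bsub>?A\<^esub> (I +>\<^bsub>A\<^esub> b) \<oplus>\<^bsub>?A\<^esub> (I +>\<^bsub>A\<^esub> x) \<in> lin_span F ?A ((+>\<^bsub>A\<^esub>) I ` B)"
      by (intro lin_span.add) auto
    moreover have "c \<odot>\<^bsub>?A\<^esub> (I +>\<^bsub>A\<^esub> b) \<oplus>\<^bsub>?A\<^esub> (I +>\<^bsub>A\<^esub> x) = I +>\<^bsub>A\<^esub> (c \<odot>\<^bsub>A\<^esub> b \<oplus>\<^bsub>A\<^esub> x)"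
      using add B by (auto simp: quotient_smult[OF I] quotient_add[OF I])
    ultimately show ?case
      using add B by auto
  qed
  then show ?thesis ..
qed

end


section \<open>Path algebras of quivers with finitely many vertices\<close>

text \<open>Used to see that, besides the sortedness of each factor, only the colour sets of the
  factors decide whether a product of paths has sorted colours.\<close>

lemma sorted_wrt_concat:
  "sorted_wrt P (concat xss) \<longleftrightarrow> (\<forall>xs\<in>set xss. sorted_wrt P xs) \<and>
    sorted_wrt (\<lambda>xs ys. \<forall>x\<in>set xs. \<forall>y\<in>set ys. P x y) xss"
  by (induction xss) (auto simp: sorted_wrt_append)

text \<open>Finiteness of the vertex set puts the unit, the sum of all lazy paths, into the path
  algebra; it also bounds the number of types of paths later on.\<close>

locale quiver_algebra = cring F + wf_digraph Q
  for F :: "('k, 'm) ring_scheme" (structure) and Q :: "('v, 'e) pre_digraph" +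
  assumes finite_verts: "finite (verts Q)"
begin

abbreviation FQ :: "('k, ('v, 'e) qpath \<Rightarrow> 'k) module" where
  "FQ \<equiv> path_algebra F Q"

abbreviation basis :: "('v, 'e) qpath \<Rightarrow> ('v, 'e) qpath \<Rightarrow> 'k" where
  "basis \<equiv> path_basis F"

definition splits :: "('v, 'e) qpath \<Rightarrow> (('v, 'e) qpath \<times> ('v, 'e) qpath) set" where
  "splits p = {(q, r). q \<in> qpaths Q \<and> r \<in> qpaths Q
                \<and> path_target Q q = path_source r \<and> path_concat q r = p}"

lemma qpaths_iff: "p \<in> qpaths Q \<longleftrightarrow> awalk (fst p) (snd p) (path_target Q p)"
  by (cases p) (auto simp: qpaths_def path_target_def)

lemma path_concat_in_qpaths:
  "\<lbrakk>p \<in> qpaths Q; q \<in> qpaths Q; path_target Q p = path_source q\<rbrakk> \<Longrightarrow> path_concat p q \<in> qpaths Q"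
  by (auto simp: qpaths_def path_concat_def path_target_def path_source_def intro: awalk_appendI)

lemma path_target_concat:
  assumes "p \<in> qpaths Q" "q \<in> qpaths Q" "path_target Q p = path_source q"
  shows "path_target Q (path_concat p q) = path_target Q q"
proof -
  have "awalk (fst p) (snd p @ snd q) (path_target Q q)"
    using assms by (auto simp: qpaths_iff path_source_def intro: awalk_appendI)
  then show ?thesis
    by (auto simp: path_target_def path_concat_def)
qed

lemma path_target_in_verts: "p \<in> qpaths Q \<Longrightarrow> path_target Q p \<in> verts Q"
  by (auto simp: qpaths_iff dest: awalk_last_in_verts)

lemma path_source_in_verts: "p \<in> qpaths Q \<Longrightarrow> path_source p \<in> verts Q"
  by (auto simp: qpaths_iff path_source_def dest: awalk_hd_in_verts)

lemma lazy_path_in_qpaths: "(u, []) \<in> qpaths Q \<longleftrightarrow> u \<in> verts Q"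
  by (auto simp: qpaths_def awalk_Nil_iff)

text \<open>A decomposition is determined by the position of the cut, since the second factor must
  start at the target of the first.\<close>

lemma finite_splits: "finite (splits p)"
proof -
  have "splits p \<subseteq> (\<lambda>k. ((fst p, take k (snd p)),
      (path_target Q (fst p, take k (snd p)), drop k (snd p)))) ` {..length (snd p)}"
  proof
    fix d assume "d \<in> splits p"
    then show "d \<in> (\<lambda>k. ((fst p, take k (snd p)),
        (path_target Q (fst p, take k (snd p)), drop k (snd p)))) ` {..length (snd p)}"
      by (intro image_eqI[of _ _ "length (snd (fst d))"])
        (auto simp: splits_def path_concat_def path_source_def)
  qed
  then show ?thesis
    by (rule finite_subset) simp
qed

lemma splits_notin_qpaths: "p \<notin> qpaths Q \<Longrightarrow> splits p = {}"
  by (auto simp: splits_def path_concat_in_qpaths)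

section \<open>The algebra structure on finitely supported functions\<close>

lemma FQ_carrierI:
  "\<lbrakk>\<And>p. f p \<in> carrier F; \<And>p. p \<notin> qpaths Q \<Longrightarrow> f p = \<zero>; finite {p. f p \<noteq> \<zero>}\<rbrakk> \<Longrightarrow> f \<in> carrier FQ"
  by (simp add: path_algebra_def)

lemma FQ_coeff_closed: "f \<in> carrier FQ \<Longrightarrow> f p \<in> carrier F"
  and FQ_coeff_outside: "\<lbrakk>f \<in> carrier FQ; p \<notin> qpaths Q\<rbrakk> \<Longrightarrow> f p = \<zero>"
  and FQ_finite_support: "f \<in> carrier FQ \<Longrightarrow> finite {p. f p \<noteq> \<zero>}"
  unfolding path_algebra_def by (simp_all del: split_paired_All)

lemma FQ_zero: "\<zero>\<^bsub>FQ\<^esub> = (\<lambda>p. \<zero>)"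
  and FQ_add: "f \<oplus>\<^bsub>FQ\<^esub> g = (\<lambda>p. f p \<oplus> g p)"
  and FQ_smult: "c \<odot>\<^bsub>FQ\<^esub> f = (\<lambda>p. c \<otimes> f p)"
  and FQ_one: "\<one>\<^bsub>FQ\<^esub> = (\<lambda>p. if p \<in> qpaths Q \<and> snd p = [] then \<one> else \<zero>)"
  and FQ_mult: "f \<otimes>\<^bsub>FQ\<^esub> g = (\<lambda>p. \<Oplus>d \<in> splits p. f (fst d) \<otimes> g (snd d))"
  by (simp_all add: path_algebra_def splits_def)

lemma FQ_zero_closed: "\<zero>\<^bsub>FQ\<^esub> \<in> carrier FQ"
  by (auto intro: FQ_carrierI simp: FQ_zero)

lemma FQ_add_closed:
  assumes "f \<in> carrier FQ" "g \<in> carrier FQ"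
  shows "f \<oplus>\<^bsub>FQ\<^esub> g \<in> carrier FQ"
proof (rule FQ_carrierI)
  have "{p. (f \<oplus>\<^bsub>FQ\<^esub> g) p \<noteq> \<zero>} \<subseteq> {p. f p \<noteq> \<zero>} \<union> {p. g p \<noteq> \<zero>}"
    by (auto simp: FQ_add)
  then show "finite {p. (f \<oplus>\<^bsub>FQ\<^esub> g) p \<noteq> \<zero>}"
    using assms by (auto intro: finite_subset simp: FQ_finite_support)
qed (use assms in \<open>auto simp: FQ_add FQ_coeff_closed FQ_coeff_outside\<close>)

lemma FQ_smult_closed:
  assumes "c \<in> carrier F" "f \<in> carrier FQ"
  shows "c \<odot>\<^bsub>FQ\<^esub> f \<in> carrier FQ"
proof (rule FQ_carrierI)
  have "{p. (c \<odot>\<^bsub>FQ\<^esub> f) p \<noteq> \<zero>} \<subseteq> {p. f p \<noteq> \<zero>}"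
    using assms by (auto simp: FQ_smult)
  then show "finite {p. (c \<odot>\<^bsub>FQ\<^esub> f) p \<noteq> \<zero>}"
    using assms by (auto intro: finite_subset simp: FQ_finite_support)
qed (use assms in \<open>auto simp: FQ_smult FQ_coeff_closed FQ_coeff_outside\<close>)

lemma FQ_one_closed: "\<one>\<^bsub>FQ\<^esub> \<in> carrier FQ"
proof (rule FQ_carrierI)
  have "{p. \<one>\<^bsub>FQ\<^esub> p \<noteq> \<zero>} \<subseteq> (\<lambda>u. (u, [])) ` verts Q"
    by (auto simp: FQ_one lazy_path_in_qpaths split: if_splits)
  then show "finite {p. \<one>\<^bsub>FQ\<^esub> p \<noteq> \<zero>}"
    using finite_verts finite_surj by blast
qed (auto simp: FQ_one)

lemma FQ_mult_closed:
  assumes f: "f \<in> carrier FQ" and g: "g \<in> carrier FQ"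
  shows "f \<otimes>\<^bsub>FQ\<^esub> g \<in> carrier FQ"
proof (rule FQ_carrierI)
  \<comment> \<open>A nonzero coefficient of the product requires a nonzero summand, hence a
    factorisation of p into a path in the support of f and one in the support of g.\<close>
  have "{p. (f \<otimes>\<^bsub>FQ\<^esub> g) p \<noteq> \<zero>}
      \<subseteq> (\<lambda>(q, r). path_concat q r) ` ({q. f q \<noteq> \<zero>} \<times> {r. g r \<noteq> \<zero>})"
  proof
    fix p assume "p \<in> {p. (f \<otimes>\<^bsub>FQ\<^esub> g) p \<noteq> \<zero>}"
    then have "\<exists>d\<in>splits p. f (fst d) \<otimes> g (snd d) \<noteq> \<zero>"
      unfolding FQ_mult by (auto intro: add.finprod_one_eqI)
    then obtain q r where "(q, r) \<in> splits p" and "f q \<otimes> g r \<noteq> \<zero>"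
      by auto
    moreover from this have "f q \<noteq> \<zero>" "g r \<noteq> \<zero>"
      using f g FQ_coeff_closed by (metis l_null r_null)+
    ultimately show "p \<in> (\<lambda>(q, r). path_concat q r) ` ({q. f q \<noteq> \<zero>} \<times> {r. g r \<noteq> \<zero>})"
      by (auto simp: splits_def)
  qed
  then show "finite {p. (f \<otimes>\<^bsub>FQ\<^esub> g) p \<noteq> \<zero>}"
    using f g by (auto intro: finite_subset simp: FQ_finite_support)
qed (use f g in \<open>auto simp: FQ_mult FQ_coeff_closed splits_notin_qpaths\<close>)

lemma basis_closed: "p \<in> qpaths Q \<Longrightarrow> basis p \<in> carrier FQ"
  by (rule FQ_carrierI) (auto simp: path_basis_def)

text \<open>Peeling one path at a time off the support reduces linear statements about f to
  statements about paths.\<close>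

lemma FQ_induct [consumes 1, case_names zero add]:
  assumes "f \<in> carrier FQ"
    and zero: "P \<zero>\<^bsub>FQ\<^esub>"
    and add: "\<And>c p f. \<lbrakk>c \<in> carrier F; p \<in> qpaths Q; f \<in> carrier FQ; P f\<rbrakk>
      \<Longrightarrow> P (c \<odot>\<^bsub>FQ\<^esub> basis p \<oplus>\<^bsub>FQ\<^esub> f)"
  shows "P f"
proof -
  have "P f" if "finite S" "f \<in> carrier FQ" "{p. f p \<noteq> \<zero>} = S" for S f
    using that
  proof (induction S arbitrary: f)
    case empty
    then show ?case
    proof -
      have "f = \<zero>\<^bsub>FQ\<^esub>"
        using empty.prems(2) by (auto simp: FQ_zero fun_eq_iff simp del: split_paired_All)
      then show ?thesis
        using zero by simp
    qed
  next
    case (insert p S)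
    let ?g = "f(p := \<zero>)"
    have supp: "{q. ?g q \<noteq> \<zero>} = S"
      using insert by auto
    have g: "?g \<in> carrier FQ"
    proof (rule FQ_carrierI)
      show "finite {q. ?g q \<noteq> \<zero>}"
        using supp insert.hyps by simp
    qed (use insert.prems in \<open>auto simp: FQ_coeff_closed FQ_coeff_outside\<close>)
    have "f = f p \<odot>\<^bsub>FQ\<^esub> basis p \<oplus>\<^bsub>FQ\<^esub> ?g"
      using insert.prems by (auto simp: FQ_add FQ_smult path_basis_def FQ_coeff_closed)
    moreover have "p \<in> qpaths Q"
      using insert.prems FQ_coeff_outside by blast
    ultimately show ?case
      using add[OF _ _ g insert.IH[OF g supp]] insert.prems FQ_coeff_closed by metis
  qed
  then show ?thesis
    using assms(1) FQ_finite_support by blast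
qed

lemma FQ_abelian_group: "abelian_group FQ"
proof (rule abelian_groupI)
  fix f assume f: "f \<in> carrier FQ"
  have "((\<ominus> \<one>) \<odot>\<^bsub>FQ\<^esub> f) \<oplus>\<^bsub>FQ\<^esub> f = \<zero>\<^bsub>FQ\<^esub>"
    using f by (auto simp: FQ_add FQ_smult FQ_zero FQ_coeff_closed l_minus l_neg)
  then show "\<exists>g\<in>carrier FQ. g \<oplus>\<^bsub>FQ\<^esub> f = \<zero>\<^bsub>FQ\<^esub>"
    using f by (blast intro: FQ_smult_closed)
qed (auto simp: FQ_add_closed FQ_zero_closed,
    auto simp: FQ_add FQ_zero FQ_coeff_closed a_ac)

lemma FQ_module: "module F FQ"
  by (rule moduleI[OF is_cring FQ_abelian_group])
    (auto simp: FQ_smult_closed, auto simp: FQ_smult FQ_add FQ_coeff_closed l_distr r_distr m_assoc)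

lemma FQ_l_distr:
  "\<lbrakk>f \<in> carrier FQ; g \<in> carrier FQ; h \<in> carrier FQ\<rbrakk>
    \<Longrightarrow> (f \<oplus>\<^bsub>FQ\<^esub> g) \<otimes>\<^bsub>FQ\<^esub> h = f \<otimes>\<^bsub>FQ\<^esub> h \<oplus>\<^bsub>FQ\<^esub> g \<otimes>\<^bsub>FQ\<^esub> h"
  by (auto simp: FQ_mult FQ_add FQ_coeff_closed l_distr Pi_def simp flip: finsum_addf)

lemma FQ_r_distr:
  "\<lbrakk>f \<in> carrier FQ; g \<in> carrier FQ; h \<in> carrier FQ\<rbrakk>
    \<Longrightarrow> h \<otimes>\<^bsub>FQ\<^esub> (f \<oplus>\<^bsub>FQ\<^esub> g) = h \<otimes>\<^bsub>FQ\<^esub> f \<oplus>\<^bsub>FQ\<^esub> h \<otimes>\<^bsub>FQ\<^esub> g"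
  by (auto simp: FQ_mult FQ_add FQ_coeff_closed r_distr Pi_def simp flip: finsum_addf)

lemma FQ_smult_mult_left:
  "\<lbrakk>c \<in> carrier F; f \<in> carrier FQ; g \<in> carrier FQ\<rbrakk>
    \<Longrightarrow> (c \<odot>\<^bsub>FQ\<^esub> f) \<otimes>\<^bsub>FQ\<^esub> g = c \<odot>\<^bsub>FQ\<^esub> (f \<otimes>\<^bsub>FQ\<^esub> g)"
  by (auto simp: FQ_mult FQ_smult FQ_coeff_closed finsum_rdistr finite_splits m_assoc Pi_def)

lemma FQ_smult_mult_right:
  "\<lbrakk>c \<in> carrier F; f \<in> carrier FQ; g \<in> carrier FQ\<rbrakk>
    \<Longrightarrow> f \<otimes>\<^bsub>FQ\<^esub> (c \<odot>\<^bsub>FQ\<^esub> g) = c \<odot>\<^bsub>FQ\<^esub> (f \<otimes>\<^bsub>FQ\<^esub> g)"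
  by (auto simp: FQ_mult FQ_smult FQ_coeff_closed finsum_rdistr finite_splits m_lcomm Pi_def)

text \<open>At a path s only the pair (p, q) can contribute, and it decomposes s only if the end
  points match and s is the concatenation.\<close>

lemma basis_mult:
  assumes "p \<in> qpaths Q" "q \<in> qpaths Q"
  shows "basis p \<otimes>\<^bsub>FQ\<^esub> basis q =
    (if path_target Q p = path_source q then basis (path_concat p q) else \<zero>\<^bsub>FQ\<^esub>)"
proof
  fix s
  have "(basis p \<otimes>\<^bsub>FQ\<^esub> basis q) s = (\<Oplus>d\<in>splits s. if (p, q) = d then \<one> else \<zero>)"
    unfolding FQ_mult by (rule finsum_cong') (auto simp: path_basis_def)
  also have "\<dots> = (if (p, q) \<in> splits s then \<one> else \<zero>)"
  proof (cases "(p, q) \<in> splits s")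
    case True
    then show ?thesis
      using finsum_singleton[OF True finite_splits, of "\<lambda>_. \<one>"] by simp
  next
    case False
    then have "(\<Oplus>d\<in>splits s. if (p, q) = d then \<one> else \<zero>) = \<zero>"
      by (intro add.finprod_one_eqI) auto
    then show ?thesis
      using False by simp
  qed
  also have "\<dots> = (if path_target Q p = path_source q then basis (path_concat p q) else \<zero>\<^bsub>FQ\<^esub>) s"
    using assms by (auto simp: splits_def path_basis_def FQ_zero)
  finally show "(basis p \<otimes>\<^bsub>FQ\<^esub> basis q) s = \<dots>" .
qed

lemma FQ_l_null: "f \<in> carrier FQ \<Longrightarrow> \<zero>\<^bsub>FQ\<^esub> \<otimes>\<^bsub>FQ\<^esub> f = \<zero>\<^bsub>FQ\<^esub>"
  and FQ_r_null: "f \<in> carrier FQ \<Longrightarrow> f \<otimes>\<^bsub>FQ\<^esub> \<zero>\<^bsub>FQ\<^esub> = \<zero>\<^bsub>FQ\<^esub>"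
  by (auto simp: FQ_mult FQ_zero FQ_coeff_closed)

lemma basis_mult_assoc:
  assumes "p \<in> qpaths Q" "q \<in> qpaths Q" "r \<in> qpaths Q"
  shows "(basis p \<otimes>\<^bsub>FQ\<^esub> basis q) \<otimes>\<^bsub>FQ\<^esub> basis r = basis p \<otimes>\<^bsub>FQ\<^esub> (basis q \<otimes>\<^bsub>FQ\<^esub> basis r)"
proof -
  have "path_source (path_concat q r) = path_source q"
    by (simp add: path_source_def path_concat_def)
  moreover have "path_concat (path_concat p q) r = path_concat p (path_concat q r)"
    by (simp add: path_concat_def)
  ultimately show ?thesis
    using assms
    by (simp add: basis_mult FQ_l_null FQ_r_null basis_closed path_concat_in_qpaths path_target_concat)
qed

lemma FQ_mult_assoc:
  assumes "f \<in> carrier FQ" "g \<in> carrier FQ" "h \<in> carrier FQ"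
  shows "(f \<otimes>\<^bsub>FQ\<^esub> g) \<otimes>\<^bsub>FQ\<^esub> h = f \<otimes>\<^bsub>FQ\<^esub> (g \<otimes>\<^bsub>FQ\<^esub> h)"
proof -
  note closed = FQ_add_closed FQ_smult_closed FQ_mult_closed basis_closed
  note linear = FQ_l_null FQ_r_null FQ_l_distr FQ_r_distr FQ_smult_mult_left FQ_smult_mult_right closed
  \<comment> \<open>Both sides are linear in each factor. Starting from three paths, the law is
    extended to arbitrary elements first in f, then in g, then in h.\<close>
  have *: "(f \<otimes>\<^bsub>FQ\<^esub> basis q) \<otimes>\<^bsub>FQ\<^esub> basis r = f \<otimes>\<^bsub>FQ\<^esub> (basis q \<otimes>\<^bsub>FQ\<^esub> basis r)"
    if "f \<in> carrier FQ" "q \<in> qpaths Q" "r \<in> qpaths Q" for f q r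
    using that by (induction rule: FQ_induct) (simp_all add: linear basis_mult_assoc)
  have **: "(f \<otimes>\<^bsub>FQ\<^esub> g) \<otimes>\<^bsub>FQ\<^esub> basis r = f \<otimes>\<^bsub>FQ\<^esub> (g \<otimes>\<^bsub>FQ\<^esub> basis r)"
    if "g \<in> carrier FQ" "f \<in> carrier FQ" "r \<in> qpaths Q" for f g r
    using that by (induction rule: FQ_induct) (simp_all add: linear *)
  from assms(3,1,2) show ?thesis
    by (induction rule: FQ_induct) (simp_all add: linear **)
qed

lemma FQ_l_one:
  assumes f: "f \<in> carrier FQ"
  shows "\<one>\<^bsub>FQ\<^esub> \<otimes>\<^bsub>FQ\<^esub> f = f"
proof
  fix p
  show "(\<one>\<^bsub>FQ\<^esub> \<otimes>\<^bsub>FQ\<^esub> f) p = f p"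
  proof (cases "p \<in> qpaths Q")
    case True
    \<comment> \<open>Only the decomposition that splits off the lazy path at the start of p can
      have a nonzero summand.\<close>
    let ?d = "((fst p, []), p)"
    have "(\<one>\<^bsub>FQ\<^esub> \<otimes>\<^bsub>FQ\<^esub> f) p = (\<Oplus>d\<in>splits p. if ?d = d then f p else \<zero>)"
      unfolding FQ_mult using f
      by (intro finsum_cong')
        (auto simp: FQ_one FQ_coeff_closed splits_def path_concat_def path_target_def path_source_def)
    also have "\<dots> = f p"
    proof -
      have "?d \<in> splits p"
        using True by (cases p) (auto simp: splits_def path_concat_def path_target_def path_source_def
            lazy_path_in_qpaths dest: path_source_in_verts)
      from finsum_singleton[OF this finite_splits, of "\<lambda>_. f p"] show ?thesis
        using f by (simp add: FQ_coeff_closed)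
    qed
    finally show ?thesis .
  qed (use f in \<open>simp add: FQ_mult splits_notin_qpaths FQ_coeff_outside\<close>)
qed

lemma FQ_r_one:
  assumes f: "f \<in> carrier FQ"
  shows "f \<otimes>\<^bsub>FQ\<^esub> \<one>\<^bsub>FQ\<^esub> = f"
proof
  fix p
  show "(f \<otimes>\<^bsub>FQ\<^esub> \<one>\<^bsub>FQ\<^esub>) p = f p"
  proof (cases "p \<in> qpaths Q")
    case True
    let ?d = "(p, (path_target Q p, []))"
    have "(f \<otimes>\<^bsub>FQ\<^esub> \<one>\<^bsub>FQ\<^esub>) p = (\<Oplus>d\<in>splits p. if ?d = d then f p else \<zero>)"
      unfolding FQ_mult using f
      by (intro finsum_cong')
        (auto simp: FQ_one FQ_coeff_closed splits_def path_concat_def path_source_def)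
    also have "\<dots> = f p"
    proof -
      have "?d \<in> splits p"
        using True by (auto simp: splits_def path_concat_def path_source_def
            lazy_path_in_qpaths path_target_in_verts)
      from finsum_singleton[OF this finite_splits, of "\<lambda>_. f p"] show ?thesis
        using f by (simp add: FQ_coeff_closed)
    qed
    finally show ?thesis .
  qed (use f in \<open>simp add: FQ_mult splits_notin_qpaths FQ_coeff_outside\<close>)
qed

lemma FQ_assoc_algebra: "assoc_algebra F FQ"
proof -
  have "monoid FQ"
    by (rule monoidI) (simp_all add: FQ_mult_closed FQ_one_closed FQ_mult_assoc FQ_l_one FQ_r_one)
  then have "ring FQ"
    by (intro ringI FQ_abelian_group FQ_l_distr FQ_r_distr)
  then show ?thesis
    by (intro assoc_algebra.intro FQ_module assoc_algebra_axioms.intro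
        FQ_smult_mult_left FQ_smult_mult_right)
qed


section \<open>Products of paths and exchange of factors\<close>

lemma carrier_FQ_lin_span: "carrier FQ \<subseteq> lin_span F FQ (basis ` qpaths Q)"
proof
  fix f assume "f \<in> carrier FQ"
  then show "f \<in> lin_span F FQ (basis ` qpaths Q)"
    by (induction rule: FQ_induct) (auto intro: lin_span.intros)
qed

definition composable :: "('v, 'e) qpath list \<Rightarrow> bool" where
  "composable = successively (\<lambda>p q. path_target Q p = path_source q)"

text \<open>The starting vertex is taken from the first factor because the arrows do not reveal it
  when all factors are lazy.\<close>

definition composite :: "('v, 'e) qpath list \<Rightarrow> ('v, 'e) qpath" where
  "composite ps = (path_source (hd ps), concat (map snd ps))"

lemma composite_Cons: "ps \<noteq> [] \<Longrightarrow> composite (p # ps) = path_concat p (composite ps)"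
  by (simp add: composite_def path_concat_def path_source_def)

lemma path_source_composite: "path_source (composite ps) = path_source (hd ps)"
  by (simp add: composite_def path_source_def)

lemma composite_in_qpaths:
  "\<lbrakk>ps \<noteq> []; set ps \<subseteq> qpaths Q; composable ps\<rbrakk> \<Longrightarrow> composite ps \<in> qpaths Q"
proof (induction ps)
  case (Cons p ps)
  show ?case
  proof (cases "ps = []")
    case True
    then show ?thesis
      using Cons.prems by (simp add: composite_def path_source_def)
  next
    case False
    then show ?thesis
      using Cons unfolding composite_Cons[OF False]
      by (intro path_concat_in_qpaths)
        (simp_all add: composable_def successively_Cons path_source_composite)
  qed
qed simp

text \<open>The last path absorbs the trailing unit; the remaining factors are attached from the
  right, and a single mismatch of end points makes the product zero.\<close>

lemma basis_prod:
  "\<lbrakk>ps \<noteq> []; set ps \<subseteq> qpaths Q\<rbrakk> \<Longrightarrow>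
    foldr (\<lambda>p f. basis p \<otimes>\<^bsub>FQ\<^esub> f) ps \<one>\<^bsub>FQ\<^esub> =
      (if composable ps then basis (composite ps) else \<zero>\<^bsub>FQ\<^esub>)"
proof (induction ps)
  case (Cons p ps)
  show ?case
  proof (cases "ps = []")
    case True
    then show ?thesis
      using Cons.prems
      by (simp add: FQ_r_one basis_closed composable_def composite_def path_source_def)
  next
    case False
    then show ?thesis
      using Cons composite_in_qpaths[of ps]
      by (simp add: basis_mult FQ_r_null basis_closed composite_Cons path_source_composite
          composable_def successively_Cons)
  qed
qed simp

text \<open>At each vertex the colour selects at most one outgoing arrow, so the walk can be
  reconstructed arrow by arrow from its start.\<close>

lemma coloured_walk_unique:
  fixes c :: "'e \<Rightarrow> bool"
  assumes det: "\<And>e e'. \<lbrakk>e \<in> arcs Q; e' \<in> arcs Q; tail Q e = tail Q e'; c e = c e'\<rbrakk> \<Longrightarrow> e = e'"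
  shows "\<lbrakk>awalk u es v; awalk u es' v'; map c es = map c es'\<rbrakk> \<Longrightarrow> es = es'"
proof (induction es arbitrary: u es')
  case (Cons e es)
  then obtain e' es'' where es': "es' = e' # es''"
    by auto
  with Cons.prems have "e = e'"
    by (intro det) (auto simp: awalk_Cons_iff)
  with Cons es' show ?case
    by (auto simp: awalk_Cons_iff)
qed simp

text \<open>The end points govern composability, the colours the order condition between factors.
  Multiplicities of colours are forgotten so that only finitely many types exist.\<close>

definition path_type :: "('e \<Rightarrow> bool) \<Rightarrow> ('v, 'e) qpath \<Rightarrow> 'v \<times> 'v \<times> bool set" where
  "path_type c p = (path_source p, path_target Q p, c ` set (snd p))"

lemma composable_cong_path_type:
  assumes "\<And>k. k \<in> set w \<Longrightarrow> path_type c (P k) = path_type c (R k)"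
  shows "composable (map P w) \<longleftrightarrow> composable (map R w)"
  using assms unfolding composable_def successively_map path_type_def
  by (intro successively_cong) auto

text \<open>The exchange permutes blocks of arrows and so preserves the number of arrows of each
  colour. A sorted colour sequence is determined by these numbers, and together with the starting
  vertex it determines the path.\<close>

lemma composite_transpose:
  assumes det: "\<And>e e'. \<lbrakk>e \<in> arcs Q; e' \<in> arcs Q; tail Q e = tail Q e'; c e = c e'\<rbrakk> \<Longrightarrow> e = e'"
    and w: "w \<in> perm_words N" "w \<noteq> []" and ij: "i \<in> {1..N}" "j \<in> {1..N}"
    and P: "\<And>k. k \<in> {1..N} \<Longrightarrow> P k \<in> qpaths Q"
    and type: "path_type c (P i) = path_type c (P j)"
    and comp: "composable (map P w)"
  defines "R \<equiv> P \<circ> transpose i j"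
  shows "sorted (map c (snd (composite (map R w)))) \<longleftrightarrow> sorted (map c (snd (composite (map P w))))"
    and "sorted (map c (snd (composite (map P w)))) \<Longrightarrow> composite (map R w) = composite (map P w)"
proof -
  have tw: "set (map (transpose i j) w) = set w" "distinct (map (transpose i j) w)" "distinct w"
    using w map_transpose_perm_words[OF w(1) ij] by (auto simp: perm_words_def)
  have R_type: "path_type c (R k) = path_type c (P k)" for k
    using type by (auto simp: R_def transpose_def)
  \<comment> \<open>Apart from the set of factors only their types enter on the right, and the
    exchange changes neither.\<close>
  have sorted_iff: "sorted (map c (snd (composite (map S w)))) \<longleftrightarrow>
      (\<forall>p \<in> S ` set w. sorted (map c (snd p))) \<and>
      sorted_wrt (\<lambda>k l. \<forall>x \<in> snd (snd (path_type c (S k))).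
        \<forall>y \<in> snd (snd (path_type c (S l))). x \<le> y) w" for S
    by (simp add: composite_def sorted_wrt_map sorted_wrt_concat path_type_def comp_def)
  have R_image: "R ` set w = P ` set w"
    using tw(1) by (metis R_def image_comp image_set)
  show iff: "sorted (map c (snd (composite (map R w)))) \<longleftrightarrow>
      sorted (map c (snd (composite (map P w))))"
    unfolding sorted_iff R_image R_type ..
  assume sorted: "sorted (map c (snd (composite (map P w))))"
  have w_set: "set w = {1..N}"
    using w by (simp add: perm_words_def)
  have "composable (map R w)"
    using comp R_type by (subst composable_cong_path_type[where R = P]) auto
  moreover have "R ` set w \<subseteq> qpaths Q" "P ` set w \<subseteq> qpaths Q"
    using R_image P w_set by auto
  ultimately have in_qpaths: "composite (map R w) \<in> qpaths Q" "composite (map P w) \<in> qpaths Q"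
    using comp w by (auto intro!: composite_in_qpaths)
  have source: "fst (composite (map R w)) = fst (composite (map P w))"
    using R_type[of "hd w"] w by (simp add: composite_def path_type_def hd_map)
  have "mset (map (transpose i j) w) = mset w"
    using tw by (metis set_eq_iff_mset_eq_distinct)
  then have "mset (map (\<lambda>k. mset (snd (R k))) w) = mset (map (\<lambda>k. mset (snd (P k))) w)"
    by (metis (mono_tags, lifting) R_def comp_apply list.map_comp map_eq_conv mset_map)
  then have "mset (snd (composite (map R w))) = mset (snd (composite (map P w)))"
    by (simp add: composite_def mset_concat comp_def flip: sum_mset_sum_list)
  \<comment> \<open>Two sorted lists with the same multiset of entries are equal.\<close>
  then have "map c (snd (composite (map R w))) = map c (snd (composite (map P w)))"
    using sorted iff by (metis mset_map properties_for_sort)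
  then have "snd (composite (map R w)) = snd (composite (map P w))"
    using in_qpaths source unfolding qpaths_iff
    by (intro coloured_walk_unique[where c = c]) (simp_all add: det)
  then show "composite (map R w) = composite (map P w)"
    using source by (simp add: prod_eq_iff)
qed

text \<open>This isolates what the argument uses of the glued cycles. As False < True, sorted
  colours mean that the arrows coloured False come before those coloured True.\<close>

theorem PI_quotient_of_coloured:
  fixes c :: "'e \<Rightarrow> bool"
  assumes one: "\<one> \<noteq> \<zero>" and I: "ideal I FQ"
    and det: "\<And>e e'. \<lbrakk>e \<in> arcs Q; e' \<in> arcs Q; tail Q e = tail Q e'; c e = c e'\<rbrakk> \<Longrightarrow> e = e'"
    and unsorted: "\<And>p. \<lbrakk>p \<in> qpaths Q; \<not> sorted (map c (snd p))\<rbrakk> \<Longrightarrow> basis p \<in> I"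
  shows "PI_algebra F (quotient_algebra FQ I)"
proof -
  interpret FQ: assoc_algebra F FQ
    by (rule FQ_assoc_algebra)
  let ?A = "quotient_algebra FQ I"
  interpret A: assoc_algebra F ?A
    using I by (rule FQ.quotient_assoc_algebra)
  \<comment> \<open>\<open>?T\<close> contains all types of paths, so among N paths two have the
    same type by the pigeonhole principle.\<close>
  let ?T = "verts Q \<times> verts Q \<times> (UNIV :: bool set set)"
  define N where "N = Suc (card ?T)"
  let ?B = "(+>\<^bsub>FQ\<^esub>) I ` basis ` qpaths Q"
  have basis_carrier: "basis ` qpaths Q \<subseteq> carrier FQ"
    by (auto simp: basis_closed)
  have span: "carrier ?A \<subseteq> lin_span F ?A ?B"
    using FQ.lin_span_quotient[OF I basis_carrier] carrier_FQ_lin_span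
    by (auto simp: FQ.quotient_carrier[OF I])
  have B: "?B \<subseteq> carrier ?A"
    using basis_carrier by (auto simp: FQ.quotient_carrier[OF I])
  have "A.standard_eval N b = \<zero>\<^bsub>?A\<^esub>" if b: "b \<in> {1..N} \<rightarrow> ?B" for b
  proof -
    have "\<forall>k\<in>{1..N}. \<exists>p. p \<in> qpaths Q \<and> b k = I +>\<^bsub>FQ\<^esub> basis p"
      using b by (fastforce simp: Pi_iff simp del: split_paired_Ex)
    then obtain P where P: "\<And>k. k \<in> {1..N} \<Longrightarrow> P k \<in> qpaths Q"
      "\<And>k. k \<in> {1..N} \<Longrightarrow> b k = I +>\<^bsub>FQ\<^esub> basis (P k)"
      by metis
    have "(\<lambda>k. path_type c (P k)) ` {1..N} \<subseteq> ?T"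
      using P by (auto simp: path_type_def path_source_in_verts path_target_in_verts)
    then have "card ((\<lambda>k. path_type c (P k)) ` {1..N}) < card {1..N}"
      using card_mono[of ?T] finite_verts by (simp add: N_def less_Suc_eq_le)
    then have "\<not> inj_on (\<lambda>k. path_type c (P k)) {1..N}"
      using card_image by (metis less_irrefl)
    then obtain i j where ij: "i \<in> {1..N}" "j \<in> {1..N}" "i \<noteq> j"
      and type: "path_type c (P i) = path_type c (P j)"
      by (auto simp: inj_on_def)
    \<comment> \<open>The relabelling t will be the identity for the original arguments and a
      transposition for the exchanged ones.\<close>
    have eval: "A.word_eval (b \<circ> t) w = I +>\<^bsub>FQ\<^esub>
        (if composable (map (P \<circ> t) w) then basis (composite (map (P \<circ> t) w)) else \<zero>\<^bsub>FQ\<^esub>)"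
      if w: "w \<in> perm_words N" and t: "t ` {1..N} \<subseteq> {1..N}" for w t
    proof -
      \<comment> \<open>N is a successor, so the word is nonempty as \<open>basis_prod\<close>
        demands.\<close>
      have w_set: "set w = {1..N}" "w \<noteq> []"
        using w by (auto simp: perm_words_def N_def)
      have "A.word_eval (b \<circ> t) w = A.word_eval (\<lambda>k. I +>\<^bsub>FQ\<^esub> basis (P (t k))) w"
        using P(2) t w_set by (intro A.word_eval_cong) (auto simp: image_subset_iff)
      also have "\<dots> = I +>\<^bsub>FQ\<^esub> FQ.word_eval (\<lambda>k. basis (P (t k))) w"
        using P(1) t w_set
        by (intro FQ.word_eval_quotient[OF I]) (auto intro!: basis_closed simp: image_subset_iff)
      also have "FQ.word_eval (\<lambda>k. basis (P (t k))) w =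
          foldr (\<lambda>p f. basis p \<otimes>\<^bsub>FQ\<^esub> f) (map (P \<circ> t) w) \<one>\<^bsub>FQ\<^esub>"
        by (simp add: foldr_map comp_def)
      finally show ?thesis
        using P(1) t w_set by (subst (asm) basis_prod) (auto simp: image_subset_iff)
    qed
    show ?thesis
    proof (rule A.standard_eval_symmetric_pair[OF _ ij])
      fix w assume w: "w \<in> perm_words N"
      let ?R = "P \<circ> transpose i j"
      have w_set: "set w = {1..N}" "w \<noteq> []"
        using w by (auto simp: perm_words_def N_def)
      have R: "?R k \<in> qpaths Q" if "k \<in> {1..N}" for k
        using that P(1) ij by (auto simp: transpose_def)
      have comp_iff: "composable (map ?R w) \<longleftrightarrow> composable (map P w)"
        using type by (intro composable_cong_path_type[where c = c]) (auto simp: transpose_def)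
      \<comment> \<open>If the colours are sorted, the two composites coincide. Otherwise both
        composites lie in I, and both cosets equal I.\<close>
      have "I +>\<^bsub>FQ\<^esub> basis (composite (map ?R w)) = I +>\<^bsub>FQ\<^esub> basis (composite (map P w))"
        if comp: "composable (map P w)"
      proof (cases "sorted (map c (snd (composite (map P w))))")
        case True
        have "composite (map ?R w) = composite (map P w)"
          by (rule composite_transpose(2)[OF det w w_set(2) ij(1,2) P(1) type comp True])
        then show ?thesis
          by (rule arg_cong)
      next
        case False
        have "\<not> sorted (map c (snd (composite (map ?R w))))"
          using False composite_transpose(1)[OF det w w_set(2) ij(1,2) P(1) type comp] by blast
        moreover have "composite (map ?R w) \<in> qpaths Q" "composite (map P w) \<in> qpaths Q"
          using comp comp_iff R P(1) w_set by (auto intro!: composite_in_qpaths)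
        ultimately have "basis (composite (map ?R w)) \<in> I" "basis (composite (map P w)) \<in> I"
          using False unsorted by blast+
        moreover have "abelian_subgroup I FQ"
          using I FQ_abelian_group by (intro abelian_subgroupI3 ideal.axioms(1))
        ultimately show ?thesis
          by (simp only: abelian_subgroup.a_rcos_const)
      qed
      then show "A.word_eval (b \<circ> transpose i j) w = A.word_eval b w"
        using eval[OF w, of "transpose i j"] eval[OF w, of id] comp_iff ij by simp
    qed (use b B in \<open>blast intro: Pi_mono[THEN subsetD]\<close>)
  qed
  then have "A.standard_eval N a = \<zero>\<^bsub>?A\<^esub>" if "a \<in> {1..N} \<rightarrow> carrier ?A" for a
    using that by (rule A.standard_eval_spanning[OF B span])
  then show ?thesis
    by (rule A.PI_algebra_standardI[OF one])
qed

text \<open>Cutting the path at both ends of \<open>es\<close> makes it a product of three paths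
  whose middle factor lies in I.\<close>

lemma basis_subpath_in_ideal:
  assumes I: "ideal I FQ" and walk: "awalk u (es1 @ es @ es2) w"
    and es: "basis (awlast u es1, es) \<in> I"
  shows "basis (u, es1 @ es @ es2) \<in> I"
proof -
  let ?p = "(u, es1)" and ?q = "(awlast u es1, es)" and ?r = "(awlast (awlast u es1) es, es2)"
  have paths: "?p \<in> qpaths Q" "?q \<in> qpaths Q" "?r \<in> qpaths Q"
    using walk by (auto simp: qpaths_def awalk_append_iff)
  have eq: "path_concat ?p (path_concat ?q ?r) = (u, es1 @ es @ es2)"
    by (simp add: path_concat_def)
  have "path_concat ?q ?r \<in> qpaths Q"
    using paths by (intro path_concat_in_qpaths) (simp_all add: path_target_def path_source_def)
  then have "basis (u, es1 @ es @ es2) = basis ?p \<otimes>\<^bsub>FQ\<^esub> (basis ?q \<otimes>\<^bsub>FQ\<^esub> basis ?r)"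
    using paths unfolding eq[symmetric]
    by (simp add: basis_mult path_target_def path_source_def path_concat_def)
  then show ?thesis
    using ideal.I_l_closed[OF I] ideal.I_r_closed[OF I] es paths basis_closed by simp
qed

end


section \<open>Glued cycles\<close>

text \<open>Without a descent between neighbours, transitivity would make the whole list sorted. In
  a path the two neighbours form a subpath of length two.\<close>

lemma unsorted_map_split:
  assumes "\<not> sorted (map f xs)"
  obtains ys a b zs where "xs = ys @ a # b # zs" "\<not> f a \<le> f b"
proof -
  have "\<exists>ys a b zs. xs = ys @ a # b # zs \<and> \<not> f a \<le> f b"
    using assms
  proof (induction xs rule: induct_list012)
    case (3 a b zs)
    then show ?case
      by (cases "f a \<le> f b") (metis append_Cons list.simps(9) sorted2, metis append_Nil)
  qed simp_all
  then show ?thesis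
    using that by blast
qed

lemma wf_digraph_glue:
  assumes "wf_digraph G" "wf_digraph H"
  shows "wf_digraph (glue G x H y)"
proof -
  interpret G: wf_digraph G by fact
  interpret H: wf_digraph H by fact
  show ?thesis
    by unfold_locales (auto simp: glue_def)
qed

lemma wf_digraph_oriented_cycle: "n \<ge> 1 \<Longrightarrow> wf_digraph (oriented_cycle n)"
  by unfold_locales (auto simp: oriented_cycle_def Suc_le_eq)

theorem theorem1p4:
  fixes F :: "('k, 'm) ring_scheme" and n m x y :: nat
    and Q :: "(nat + nat, nat + nat) pre_digraph"
    and v :: "nat + nat" and \<alpha> \<beta> :: "nat + nat"
  assumes "field F"
    and "n \<ge> 1" and "m \<ge> 1"
    and "x \<in> verts (oriented_cycle n)" and "y \<in> verts (oriented_cycle m)"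
    and "Q = glue (oriented_cycle n) x (oriented_cycle m) y" and "v = Inl x"
    and "\<alpha> \<in> Inl ` arcs (oriented_cycle n)" and "head Q \<alpha> = v"
    and "\<beta> \<in> Inr ` arcs (oriented_cycle m)" and "tail Q \<beta> = v"
  shows "PI_algebra F (quotient_algebra (path_algebra F Q)
           (genideal (path_algebra F Q) {path_basis F (tail Q \<alpha>, [\<alpha>, \<beta>])}))"
proof -
  interpret F: field F by fact
  \<comment> \<open>The vertex y of the second cycle is represented by \<open>Inl x\<close>, hence
    the case distinction for tails.\<close>
  have arcs: "arcs Q = Inl ` {1..n} \<union> Inr ` {1..m}"
    and tail_Inl: "tail Q (Inl i) = Inl i"
    and tail_Inr: "tail Q (Inr j) = (if j = y then Inl x else Inr j)"
    and head_Inl: "head Q (Inl i) = Inl (i mod n + 1)" for i j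
    using assms(6) by (auto simp: glue_def glue_vertex_def oriented_cycle_def)
  have "finite (verts Q)"
    using assms(6) by (simp add: glue_def oriented_cycle_def)
  moreover have "wf_digraph Q"
    using assms by (simp add: wf_digraph_glue wf_digraph_oriented_cycle)
  ultimately interpret quiver_algebra F Q
    by (intro quiver_algebra.intro quiver_algebra_axioms.intro F.is_cring)
  interpret FQ: assoc_algebra F FQ
    by (rule FQ_assoc_algebra)
  obtain i where i: "i \<in> {1..n}" "\<alpha> = Inl i" "i mod n + 1 = x"
    using assms(7-9) head_Inl by (auto simp: oriented_cycle_def)
  \<comment> \<open>Arrow j of an oriented cycle starts at vertex j, so only arrow y of the second
    cycle starts at v.\<close>
  have \<beta>: "\<beta> = Inr y" "y \<in> {1..m}"
    using assms(5,7,10,11) tail_Inr by (auto simp: oriented_cycle_def split: if_splits)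
  have "head Q \<beta> \<in> verts Q"
    using \<beta> arcs by (intro head_in_verts) simp
  \<comment> \<open>Since \<alpha>\<beta> is a genuine path, the generator lies in the path algebra
    and \<open>genideal\<close> yields an ideal.\<close>
  then have "awalk (tail Q \<alpha>) [\<alpha>, \<beta>] (head Q \<beta>)"
    using i \<beta> assms(7,9,11) arcs by (simp add: awalk_Cons_iff awalk_Nil_iff)
  then have "(tail Q \<alpha>, [\<alpha>, \<beta>]) \<in> qpaths Q"
    by (auto simp: qpaths_def)
  then have gen: "basis (tail Q \<alpha>, [\<alpha>, \<beta>]) \<in> carrier FQ"
    by (rule basis_closed)
  define I where "I = genideal FQ {basis (tail Q \<alpha>, [\<alpha>, \<beta>])}"
  have I: "ideal I FQ" "basis (tail Q \<alpha>, [\<alpha>, \<beta>]) \<in> I"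
    using gen unfolding I_def by (auto intro: FQ.genideal_ideal FQ.genideal_self')
  have "PI_algebra F (quotient_algebra FQ I)"
  \<comment> \<open>The colour is True on C(1) and False on C(2), so sorted paths run along C(2)
    first.\<close>
  proof (rule PI_quotient_of_coloured[where c = isl])
    \<comment> \<open>Within one cycle different arrows have different tails, and the gluing
      identifies only vertices of different cycles.\<close>
    fix e e' assume "tail Q e = tail Q e'" "isl e = isl e'"
    then show "e = e'"
      by (cases e; cases e') (auto simp: tail_Inl tail_Inr split: if_splits)
  next
    fix p assume p: "p \<in> qpaths Q" "\<not> sorted (map isl (snd p))"
    from p(2) obtain es1 a b es2 where es: "snd p = es1 @ a # b # es2" and "\<not> isl a \<le> isl b"
      by (rule unsorted_map_split)
    then obtain k l where ab: "a = Inl k" "b = Inr l"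
      by (cases a; cases b) auto
    have walk: "awalk (fst p) (es1 @ [a, b] @ es2) (path_target Q p)"
      using p(1) es by (simp add: qpaths_iff)
    then have last: "awlast (fst p) es1 = tail Q a"
      and adj: "a \<in> arcs Q" "head Q a = tail Q b"
      by (auto simp: awalk_append_iff awalk_Cons_iff)
    \<comment> \<open>The path can pass from C(1) to C(2) only at v, so b is \<beta> and a ends
      where \<alpha> ends.\<close>
    from adj have "l = y" "k mod n = i mod n" "k \<in> {1..n}"
      using i arcs by (auto simp: ab head_Inl tail_Inr split: if_splits)
    \<comment> \<open>Numbers in 1..n with equal residues modulo n are equal; n itself is the one
      with residue 0.\<close>
    moreover from this have "k = i"
      using i(1) by (cases "k = n"; cases "i = n") auto
    ultimately have "basis (awlast (fst p) es1, [a, b]) \<in> I"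
      using I(2) i \<beta> ab last by simp
    with I(1) walk have "basis (fst p, es1 @ [a, b] @ es2) \<in> I"
      by (rule basis_subpath_in_ideal)
    then show "basis p \<in> I"
      using es by (metis append_Cons append_Nil prod.collapse)
  qed (use I in simp_all)
  then show ?thesis
    unfolding I_def .
qed

end
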